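(* For any non-negative integer $N$, $$\begin{aligned} tG(12,1,1;2N)&=rtg(3,6,1;N),\\ tG(12,1,1;4N+1)&=2\,tpg(3,2,1;N),\\ tG(12,1,1;4N+3)&=0. \end{aligned}$$
   Context: $\mathbb{N}_0=\{0,1,2,\dots\}$. $t_n=n(n+1)/2$ (triangular numbers, $n\in\mathbb{N}_0$), $p_n=n(3n+1)/2$ (generalized pentagonal numbers, $n\in\mathbb{Z}$), $g_n=n(3n+2)$ (generalized octagonal numbers, $n\in\mathbb{Z}$). For positive integers $a_1,a_2,a_3$ and $N\in\mathbb{N}_0$: $tG(a_1,a_2,a_3;N)=|\{(l,m,n)\in\mathbb{N}_0\times\mathbb{Z}^2: N=a_1t_l+a_2g_m+a_3g_n\}|$; $rtg(a_1,a_2,a_3;N)=|\{(l,m,n)\in\mathbb{Z}\times\mathbb{N}_0\times\mathbb{Z}: N=a_1l^2+a_2t_m+a_3g_n\}|$; $tpg(a_1,a_2,a_3;N)=|\{(l,m,n)\in\mathbb{N}_0\times\mathbb{Z}^2: N=a_1t_l+a_2p_m+a_3g_n\}|$. *)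

theory Defs
  imports Main
begin

text \<open>All divisions by 2 below are exact: \<open>n * (n + 1)\<close> and \<open>n * (3 * n + 1)\<close> are always even.\<close>

definition triangular :: "nat \<Rightarrow> nat" where
  "triangular n = n * (n + 1) div 2"

definition pentagonal :: "int \<Rightarrow> int" where
  "pentagonal n = n * (3 * n + 1) div 2"

definition octagonal :: "int \<Rightarrow> int" where
  "octagonal n = n * (3 * n + 2)"

text \<open>The representation numbers are meant for positive coefficients; the solution sets are then
  finite (see the lemmas \<open>finite_tG\<close>, \<open>finite_rtg\<close>, \<open>finite_tpg\<close>),
  so \<open>card\<close> is a genuine count.\<close>

definition tG :: "nat \<Rightarrow> nat \<Rightarrow> nat \<Rightarrow> nat \<Rightarrow> nat" where
  "tG a\<^sub>1 a\<^sub>2 a\<^sub>3 N = card {(l :: nat, m :: int, n :: int).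
     int N = int a\<^sub>1 * int (triangular l) + int a\<^sub>2 * octagonal m + int a\<^sub>3 * octagonal n}"

definition rtg :: "nat \<Rightarrow> nat \<Rightarrow> nat \<Rightarrow> nat \<Rightarrow> nat" where
  "rtg a\<^sub>1 a\<^sub>2 a\<^sub>3 N = card {(l :: int, m :: nat, n :: int).
     int N = int a\<^sub>1 * l\<^sup>2 + int a\<^sub>2 * int (triangular m) + int a\<^sub>3 * octagonal n}"

definition tpg :: "nat \<Rightarrow> nat \<Rightarrow> nat \<Rightarrow> nat \<Rightarrow> nat" where
  "tpg a\<^sub>1 a\<^sub>2 a\<^sub>3 N = card {(l :: nat, m :: int, n :: int).
     int N = int a\<^sub>1 * int (triangular l) + int a\<^sub>2 * pentagonal m + int a\<^sub>3 * octagonal n}"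

lemma triangular_ge: "n \<le> triangular n"
proof (cases n)
  case (Suc k)
  have "2 * n \<le> n * (n + 1)"
    using Suc by simp
  then show ?thesis
    unfolding triangular_def by linarith
qed (simp add: triangular_def)

lemma triangular_ge_int: "\<bar>int n\<bar> \<le> int (triangular n)"
  by (simp add: triangular_ge)

lemma abs_le_square: "\<bar>n\<bar> \<le> (n :: int)\<^sup>2"
proof -
  have "\<bar>n\<bar> * 1 \<le> \<bar>n\<bar> * \<bar>n\<bar>"
    by (cases "n = 0") (auto intro!: mult_left_mono simp del: abs_mult_self_eq)
  then show ?thesis
    by (simp add: power2_eq_square)
qed

lemma octagonal_ge: "\<bar>n\<bar> \<le> octagonal n"
  using abs_le_square[of n] by (simp add: octagonal_def power2_eq_square algebra_simps)

lemma pentagonal_ge: "\<bar>n\<bar> \<le> pentagonal n"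
proof -
  have "2 * \<bar>n\<bar> \<le> n * (3 * n + 1)"
    using abs_le_square[of n] by (simp add: power2_eq_square algebra_simps)
  then show ?thesis
    unfolding pentagonal_def by linarith
qed

lemma le_pos_mult: "0 < a \<Longrightarrow> \<bar>n\<bar> \<le> y \<Longrightarrow> \<bar>n\<bar> \<le> int a * y"
  using mult_mono[of 1 "int a" "\<bar>n\<bar>" y] by simp

lemma finite_tG:
  assumes "0 < a\<^sub>1" "0 < a\<^sub>2" "0 < a\<^sub>3"
  shows "finite {(l :: nat, m :: int, n :: int).
    int N = int a\<^sub>1 * int (triangular l) + int a\<^sub>2 * octagonal m + int a\<^sub>3 * octagonal n}"
    (is "finite ?S")
proof (rule finite_subset)
  have "l \<le> N \<and> \<bar>m\<bar> \<le> int N \<and> \<bar>n\<bar> \<le> int N" if "(l, m, n) \<in> ?S" for l m n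
    using that le_pos_mult[OF assms(1) triangular_ge_int, of l]
      le_pos_mult[OF assms(2) octagonal_ge, of m] le_pos_mult[OF assms(3) octagonal_ge, of n]
    unfolding mem_Collect_eq prod.case by linarith
  then show "?S \<subseteq> {..N} \<times> {- int N..int N} \<times> {- int N..int N}"
    by fastforce
qed simp

lemma finite_rtg:
  assumes "0 < a\<^sub>1" "0 < a\<^sub>2" "0 < a\<^sub>3"
  shows "finite {(l :: int, m :: nat, n :: int).
    int N = int a\<^sub>1 * l\<^sup>2 + int a\<^sub>2 * int (triangular m) + int a\<^sub>3 * octagonal n}"
    (is "finite ?S")
proof (rule finite_subset)
  have "\<bar>l\<bar> \<le> int N \<and> m \<le> N \<and> \<bar>n\<bar> \<le> int N" if "(l, m, n) \<in> ?S" for l m n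
    using that le_pos_mult[OF assms(2) triangular_ge_int, of m]
      le_pos_mult[OF assms(1) abs_le_square, of l] le_pos_mult[OF assms(3) octagonal_ge, of n]
    unfolding mem_Collect_eq prod.case by linarith
  then show "?S \<subseteq> {- int N..int N} \<times> {..N} \<times> {- int N..int N}"
    by fastforce
qed simp

lemma finite_tpg:
  assumes "0 < a\<^sub>1" "0 < a\<^sub>2" "0 < a\<^sub>3"
  shows "finite {(l :: nat, m :: int, n :: int).
    int N = int a\<^sub>1 * int (triangular l) + int a\<^sub>2 * pentagonal m + int a\<^sub>3 * octagonal n}"
    (is "finite ?S")
proof (rule finite_subset)
  have "l \<le> N \<and> \<bar>m\<bar> \<le> int N \<and> \<bar>n\<bar> \<le> int N" if "(l, m, n) \<in> ?S" for l m n
    using that le_pos_mult[OF assms(1) triangular_ge_int, of l]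
      le_pos_mult[OF assms(2) pentagonal_ge, of m] le_pos_mult[OF assms(3) octagonal_ge, of n]
    unfolding mem_Collect_eq prod.case by linarith
  then show "?S \<subseteq> {..N} \<times> {- int N..int N} \<times> {- int N..int N}"
    by fastforce
qed simp

end

theory Submission
  imports Defs
begin

text \<open>An even value of \<open>octagonal m + octagonal n\<close> forces \<open>m\<close> and \<open>n\<close> to have equal parity, so
  the rotation \<open>m = u + v\<close>, \<open>n = u - v\<close> diagonalises the form. In the odd case exactly one of the
  two arguments is odd, and the identities \<open>g (2 a) = 8 p a\<close> and \<open>g (- 2 c - 1) = 4 g c + 1\<close>
  (for octagonal \<open>g\<close> and pentagonal \<open>p\<close>) turn the form into the one counted by \<open>tpg 3 2 1\<close>; the
  factor 2 is the choice of the odd argument. Since \<open>g\<close> is 0 or 1 modulo 4, the residue 3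
  does not occur.\<close>

text \<open>The cross terms \<open>u * v\<close> and the linear terms in \<open>v\<close> cancel, so
  \<open>v\<close> survives only as a square while \<open>u\<close> keeps its linear term.\<close>

lemma octagonal_rotate:
  "octagonal (u + v) + octagonal (u - v) = 2 * (3 * v\<^sup>2 + octagonal u)"
  by (simp add: octagonal_def power2_eq_square algebra_simps)

lemma octagonal_double: "octagonal (2 * a) = 8 * pentagonal a"
proof -
  have "even (a * (3 * a + 1))"
    by simp
  then have "2 * pentagonal a = a * (3 * a + 1)"
    unfolding pentagonal_def by (rule dvd_mult_div_cancel)
  then show ?thesis
    by (simp add: octagonal_def algebra_simps)
qed

lemma octagonal_odd: "octagonal (- 2 * c - 1) = 4 * octagonal c + 1"
  by (simp add: octagonal_def algebra_simps)

text \<open>The odd number is parametrised with a negative sign so that \<open>octagonal_odd\<close>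
  applies to it directly.\<close>

lemma odd_int_negE:
  assumes "odd (n :: int)"
  obtains c where "n = - 2 * c - 1"
proof -
  from assms obtain b where "n = 2 * b + 1"
    by (rule oddE)
  then have "n = - 2 * (- b - 1) - 1"
    by simp
  then show thesis
    by (rule that)
qed

lemma octagonal_mod_4: "octagonal n mod 4 = (if even n then 0 else 1)"
proof (cases "even n")
  case True
  then obtain a where "n = 2 * a" ..
  then show ?thesis
    by (simp add: octagonal_double mod_eq_0_iff_dvd)
next
  case False
  then obtain c where "n = - 2 * c - 1"
    by (rule odd_int_negE)
  then have "octagonal n = 1 + octagonal c * 4"
    by (simp only: octagonal_odd)
  then show ?thesis
    using False by simp
qed

text \<open>The triangular term vanishes because 4 divides 12. The two parity indicators add up to
  at most 2, so no outer reduction modulo 4 remains.\<close>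

lemma sum_octagonal_mod_4:
  assumes "int K = int 12 * t + int 1 * octagonal m + int 1 * octagonal n"
  shows "int K mod 4 = (if even m then 0 else 1) + (if even n then 0 else 1)"
proof -
  have "int K = (octagonal m + octagonal n) + 3 * t * 4"
    using assms by simp
  then have "int K mod 4 = (octagonal m + octagonal n) mod 4"
    by (simp only: mod_mult_self1)
  also have "\<dots> = (octagonal m mod 4 + octagonal n mod 4) mod 4"
    by (simp only: mod_add_eq)
  finally show ?thesis
    by (simp add: octagonal_mod_4)
qed

lemma tG_even: "tG 12 1 1 (2 * N) = rtg 3 6 1 N"
proof -
  define f :: "int \<times> nat \<times> int \<Rightarrow> nat \<times> int \<times> int"
    where "f = (\<lambda>(v, l, u). (l, u + v, u - v))"
  let ?S = "{(l :: nat, m :: int, n :: int). int (2 * N)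
    = int 12 * int (triangular l) + int 1 * octagonal m + int 1 * octagonal n}"
  let ?T = "{(v :: int, l :: nat, u :: int). int N
    = int 3 * v\<^sup>2 + int 6 * int (triangular l) + int 1 * octagonal u}"
  \<comment> \<open>After the rotation every term of the equation for \<open>?S\<close> has a factor
    2; cancelling it gives the equation for \<open>?T\<close>.\<close>
  have f_iff: "f y \<in> ?S \<longleftrightarrow> y \<in> ?T" for y
  proof (cases y)
    case (fields v l u)
    then show ?thesis
      using octagonal_rotate[of u v] by (auto simp: f_def)
  qed
  have "?S \<subseteq> f ` ?T"
  proof
    fix x
    assume x: "x \<in> ?S"
    obtain l m n where lmn: "x = (l, m, n)"
      by (cases x)
    have "even m \<longleftrightarrow> even n"
    proof -
      have "int (2 * N) mod 4 = (if even m then 0 else 1) + (if even n then 0 else 1)"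
        using x unfolding lmn by (intro sum_octagonal_mod_4) simp
      \<comment> \<open>Residue 1 is what arguments of opposite parity would produce.\<close>
      moreover have "int (2 * N) mod 4 \<noteq> 1"
        by presburger
      ultimately show ?thesis
        by (simp split: if_splits)
    qed
    then have "even (m + n)"
      by simp
    then obtain u where "m + n = 2 * u" ..
    \<comment> \<open>Inverse rotation: \<open>u\<close> is the mean of \<open>m\<close> and
      \<open>n\<close>, and \<open>u - (m - u) = n\<close>.\<close>
    then have "x = f (m - u, l, u)"
      by (simp add: f_def lmn)
    with x show "x \<in> f ` ?T"
      by (simp only: f_iff imageI)
  qed
  moreover have "f ` ?T \<subseteq> ?S"
    by (rule image_subsetI) (simp only: f_iff)
  moreover have "inj f"
    by (auto simp: inj_def f_def)
  ultimately have "bij_betw f ?T ?S"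
    unfolding bij_betw_def by (meson inj_on_subset subset_UNIV subset_antisym)
  then have "card ?T = card ?S"
    by (rule bij_betw_same_card)
  then show ?thesis
    by (simp only: tG_def rtg_def)
qed

lemma tG_1_mod_4: "tG 12 1 1 (4 * N + 1) = 2 * tpg 3 2 1 N"
proof -
  define f :: "nat \<times> int \<times> int \<Rightarrow> nat \<times> int \<times> int"
    where "f = (\<lambda>(l, a, c). (l, 2 * a, - 2 * c - 1))"
  define g :: "nat \<times> int \<times> int \<Rightarrow> nat \<times> int \<times> int"
    where "g = (\<lambda>(l, a, c). (l, - 2 * c - 1, 2 * a))"
  let ?S = "{(l :: nat, m :: int, n :: int). int (4 * N + 1)
    = int 12 * int (triangular l) + int 1 * octagonal m + int 1 * octagonal n}"
  let ?T = "{(l :: nat, a :: int, c :: int). int N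
    = int 3 * int (triangular l) + int 2 * pentagonal a + int 1 * octagonal c}"
  \<comment> \<open>Substitution gives coefficients 12, 8, 4 and a constant 1; removing the 1 on
    both sides and dividing by 4 leaves 3, 2, 1.\<close>
  have f_iff: "f y \<in> ?S \<longleftrightarrow> y \<in> ?T" for y
  proof (cases y)
    case (fields l a c)
    then show ?thesis
      using octagonal_double[of a] octagonal_odd[of c] by (auto simp: f_def)
  qed
  have g_iff: "g y \<in> ?S \<longleftrightarrow> y \<in> ?T" for y
  proof (cases y)
    case (fields l a c)
    then show ?thesis
      using octagonal_double[of a] octagonal_odd[of c] by (auto simp: g_def)
  qed
  have "?S \<subseteq> f ` ?T \<union> g ` ?T"
  proof
    fix x
    assume x: "x \<in> ?S"
    obtain l m n where lmn: "x = (l, m, n)"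
      by (cases x)
    have "int (4 * N + 1) mod 4 = (if even m then 0 else 1) + (if even n then 0 else 1)"
      using x unfolding lmn by (intro sum_octagonal_mod_4) simp
    moreover have "int (4 * N + 1) mod 4 = 1"
      by presburger
    ultimately consider "even m" "odd n" | "odd m" "even n"
      by (auto split: if_splits)
    then show "x \<in> f ` ?T \<union> g ` ?T"
    proof cases
      case 1
      obtain a where "m = 2 * a"
        using \<open>even m\<close> ..
      moreover obtain c where "n = - 2 * c - 1"
        using \<open>odd n\<close> by (rule odd_int_negE)
      ultimately have "x = f (l, a, c)"
        by (simp add: f_def lmn)
      with x show ?thesis
        by (simp only: f_iff imageI UnI1)
    next
      case 2
      obtain a where "n = 2 * a"
        using \<open>even n\<close> ..
      moreover obtain c where "m = - 2 * c - 1"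
        using \<open>odd m\<close> by (rule odd_int_negE)
      ultimately have "x = g (l, a, c)"
        by (simp add: g_def lmn)
      with x show ?thesis
        by (simp only: g_iff imageI UnI2)
    qed
  qed
  moreover have "f ` ?T \<union> g ` ?T \<subseteq> ?S"
    by (intro Un_least image_subsetI) (simp_all only: f_iff g_iff)
  ultimately have "?S = f ` ?T \<union> g ` ?T"
    by (rule subset_antisym)
  moreover have "card (f ` ?T \<union> g ` ?T) = card (f ` ?T) + card (g ` ?T)"
  proof (rule card_Un_disjoint)
    have "finite ?T"
      by (rule finite_tpg) simp_all
    then show "finite (f ` ?T)" "finite (g ` ?T)"
      by simp_all
    \<comment> \<open>The middle component is even for \<open>f\<close> and odd for
      \<open>g\<close>.\<close>
    have "f x \<noteq> g y" for x y
      by (cases x; cases y) (simp add: f_def g_def, presburger)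
    then show "f ` ?T \<inter> g ` ?T = {}"
      by blast
  qed
  moreover have "card (f ` ?T) = card ?T"
    by (rule card_image) (auto simp: inj_on_def f_def)
  moreover have "card (g ` ?T) = card ?T"
    by (rule card_image) (auto simp: inj_on_def g_def)
  ultimately have "card ?S = 2 * card ?T"
    by (simp only: mult_2)
  then show ?thesis
    by (simp only: tG_def tpg_def)
qed

lemma tG_3_mod_4: "tG 12 1 1 (4 * N + 3) = 0"
proof -
  have "int (4 * N + 3) \<noteq> int 12 * int (triangular l) + int 1 * octagonal m + int 1 * octagonal n"
    for l m n
  proof
    assume "int (4 * N + 3)
      = int 12 * int (triangular l) + int 1 * octagonal m + int 1 * octagonal n"
    then have "int (4 * N + 3) mod 4 = (if even m then 0 else 1) + (if even n then 0 else 1)"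
      by (rule sum_octagonal_mod_4)
    \<comment> \<open>Two parity indicators cannot sum to 3.\<close>
    moreover have "int (4 * N + 3) mod 4 = 3"
      by presburger
    ultimately show False
      by (simp split: if_splits)
  qed
  then show ?thesis
    by (simp only: tG_def) (simp add: split_def)
qed

theorem theorem5p11:
  fixes N :: nat
  shows "tG 12 1 1 (2 * N) = rtg 3 6 1 N \<and>
    tG 12 1 1 (4 * N + 1) = 2 * tpg 3 2 1 N \<and>
    tG 12 1 1 (4 * N + 3) = 0"
  by (intro conjI tG_even tG_1_mod_4 tG_3_mod_4)

end
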